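(* Let $\mathbb{X}$ be a Banach space, let $\mathcal{D}$ be dense in $\mathbb{X}$, and let $A:\mathcal{D}\to\mathbb{X}$ be the infinitesimal generator of a $C_0$-semigroup $T(t)$ such that $\|T(t)\|\le Ke^{\alpha t}$ for $t\ge0$, where $K\ge1$ and $\alpha\in\mathbb{R}$. Let $B:\mathbb{R}\to L(\mathbb{X})$ be a continuous function such that for each $t\in\mathbb{R}$ the range of $B(t)$ is contained in $\mathcal{D}$, $AB(t)$ is a bounded operator, and $B(t)A$ can be extended to the whole space as a bounded operator. Let $h>0$ and, for $t,u\in\mathbb{R}$ with $|t-u|\le h$, let $C_t(u)=\int_t^uB(\tau)\,d\tau$. Suppose that there are positive numbers $M$ and $\delta$ such that $\|B(t)\|\le M$ for every $t\in\mathbb{R}$ and, for all $t,u\in\mathbb{R}$ with $|u-t|\le h$, $$\|C_t(u)\|\le\delta,\qquad \|C_t(u)B(u)\|\le M\delta,\qquad \|C_t(u)A\|\le M\delta,\qquad \|AC_t(u)\|\le M\delta .$$ Let $S(t,s)$ be the evolution operator associated to the system $$\text{(ii)}\quad \dot y=Ay+B(t)y .$$ Then $$\|S(t,s)\|\le(1+\delta)Ke^{\beta(t-s)}\quad\text{for } t\ge s,\ t,s\in\mathbb{R},\qquad\text{where }\beta=\alpha+3MK\delta+\frac{\log((1+\delta)K)}{h}.$$ If $\alpha$ is negative, and $h$ is sufficiently large and $\delta$ sufficiently small in such a way that $\beta<0$, then system (ii) is asymptotically stable.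
   Context: $L(\mathbb{X})$ is the Banach space of bounded linear operators on $\mathbb{X}$ with the operator norm. The evolution operator $S(t,s)$, $t\ge s$, of $\dot y=Ay+B(t)y$ is the family of bounded operators determined by the variation of constants formula $S(t,s)=T(t-s)+\int_s^tT(t-u)B(u)S(u,s)\,du$. The operators $B(t)A$ and $C_t(u)A$ are initially defined on $\mathcal{D}$ and are identified with their bounded extensions to $\mathbb{X}$; the bound on $\|C_t(u)A\|$ refers to this extension. *)

theory Defs
  imports "HOL-Analysis.Analysis"
begin

definition C0_semigroup :: "(real \<Rightarrow> 'a::banach \<Rightarrow>\<^sub>L 'a) \<Rightarrow> bool" where
  "C0_semigroup T \<longleftrightarrow>
     T 0 = id_blinfun \<and>
     (\<forall>s\<ge>0. \<forall>t\<ge>0. T (s + t) = T s o\<^sub>L T t) \<and>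
     (\<forall>x. ((\<lambda>t. T t x) \<longlongrightarrow> x) (at_right 0))"

text \<open>An unbounded operator is a domain \<open>D\<close> together with a total function \<open>A\<close> whose values
  outside \<open>D\<close> are irrelevant; statements about \<open>A\<close> must therefore be guarded by membership in \<open>D\<close>.\<close>

definition infinitesimal_generator ::
    "(real \<Rightarrow> 'a::banach \<Rightarrow>\<^sub>L 'a) \<Rightarrow> 'a set \<Rightarrow> ('a \<Rightarrow> 'a) \<Rightarrow> bool" where
  "infinitesimal_generator T D A \<longleftrightarrow>
     D = {x. \<exists>y. ((\<lambda>t. (T t x - x) /\<^sub>R t) \<longlongrightarrow> y) (at_right 0)} \<and>
     (\<forall>x\<in>D. ((\<lambda>t. (T t x - x) /\<^sub>R t) \<longlongrightarrow> A x) (at_right 0))"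

text \<open>For dense \<open>D\<close> there is at most one such \<open>E\<close>.\<close>

definition bounded_extension ::
    "'a::banach set \<Rightarrow> ('a \<Rightarrow> 'a) \<Rightarrow> ('a \<Rightarrow>\<^sub>L 'a) \<Rightarrow> bool" where
  "bounded_extension D F E \<longleftrightarrow> (\<forall>x\<in>D. E x = F x)"

text \<open>The integral of \<open>B\<close> from \<open>t\<close> to \<open>u\<close> in the operator norm, with the usual sign
  convention when \<open>u < t\<close>.\<close>

definition oriented_integral ::
    "(real \<Rightarrow> 'a::banach \<Rightarrow>\<^sub>L 'a) \<Rightarrow> real \<Rightarrow> real \<Rightarrow> 'a \<Rightarrow>\<^sub>L 'a" where
  "oriented_integral B t u = (if t \<le> u then integral {t..u} B else - integral {u..t} B)"

text \<open>Since \<open>T\<close> is only strongly continuous, the integral in the variation of constants formula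
  is taken pointwise on vectors. Strong continuity in \<open>t\<close> makes the integrand continuous and the
  operators \<open>S t s\<close> with \<open>s \<le> t\<close> unique; the values for \<open>t < s\<close> are unconstrained.\<close>

definition evolution_operator ::
    "(real \<Rightarrow> 'a::banach \<Rightarrow>\<^sub>L 'a) \<Rightarrow> (real \<Rightarrow> 'a \<Rightarrow>\<^sub>L 'a) \<Rightarrow> (real \<Rightarrow> real \<Rightarrow> 'a \<Rightarrow>\<^sub>L 'a) \<Rightarrow> bool" where
  "evolution_operator T B S \<longleftrightarrow>
     (\<forall>s x. continuous_on {s..} (\<lambda>t. S t s x)) \<and>
     (\<forall>s t x. s \<le> t \<longrightarrow>
        S t s x = T (t - s) x + integral {s..t} (\<lambda>u. T (t - u) (B u (S u s x))))"

text \<open>Mild solutions on \<open>[s, \<infinity>)\<close> of \<open>y' = A y + B(t) y\<close>, where \<open>T\<close> is the semigroup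
  generated by \<open>A\<close>.\<close>

definition mild_solution ::
    "(real \<Rightarrow> 'a::banach \<Rightarrow>\<^sub>L 'a) \<Rightarrow> (real \<Rightarrow> 'a \<Rightarrow>\<^sub>L 'a) \<Rightarrow> real \<Rightarrow> (real \<Rightarrow> 'a) \<Rightarrow> bool" where
  "mild_solution T B s y \<longleftrightarrow>
     continuous_on {s..} y \<and>
     (\<forall>t\<ge>s. y t = T (t - s) (y s) + integral {s..t} (\<lambda>u. T (t - u) (B u (y u))))"

text \<open>Lyapunov stability of the zero solution together with attractivity. As the system is linear,
  attraction of small initial values is the same as attraction of all of them.\<close>

definition asymptotically_stable ::
    "(real \<Rightarrow> 'a::banach \<Rightarrow>\<^sub>L 'a) \<Rightarrow> (real \<Rightarrow> 'a \<Rightarrow>\<^sub>L 'a) \<Rightarrow> bool" where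
  "asymptotically_stable T B \<longleftrightarrow>
     (\<forall>s. \<forall>\<epsilon>>0. \<exists>\<eta>>0. \<forall>y. mild_solution T B s y \<and> norm (y s) < \<eta> \<longrightarrow>
        (\<forall>t\<ge>s. norm (y t) < \<epsilon>)) \<and>
     (\<forall>s y. mild_solution T B s y \<longrightarrow> (y \<longlongrightarrow> 0) at_top)"

end

theory Submission
  imports Defs
begin

text \<open>
  Let \<open>y\<close> be a mild solution on \<open>[s, t]\<close> with \<open>t - s \<le> h\<close>, and put \<open>C u = C t u\<close>, so that \<open>C\<close> has
  derivative \<open>B\<close> and \<open>C t = 0\<close>. Integrating by parts in the variation of constants formula amounts
  to differentiating \<open>T (t - u) (C u (y u))\<close>, whose right derivative is
  \<open>T (t - u) (B u + C u B u + C u A - A C u) (y u)\<close>. Moving the term with \<open>B u\<close> to the left and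
  integrating from \<open>s\<close> to \<open>t\<close>, one sees that \<open>y t\<close> differs from \<open>T (t - s) (y s - C s (y s))\<close> by at
  most the integral of \<open>3 K M \<delta> exp (\<alpha> (t - u)) \<parallel>y u\<parallel>\<close>. Gronwall's inequality gives
  \<open>\<parallel>y t\<parallel> \<le> L exp (\<gamma> (t - s)) \<parallel>y s\<parallel>\<close> with \<open>L = (1 + \<delta>) K\<close> and \<open>\<gamma> = \<alpha> + 3 M K \<delta>\<close>. As
  \<open>L exp (\<gamma> h) = exp (\<beta> h)\<close>, stepping back from \<open>t\<close> by \<open>h\<close> until the remaining interval is shorter
  than \<open>h\<close> costs the factor \<open>L\<close> only once.
\<close>

section \<open>Right derivatives and a mean value inequality\<close>

lemma has_vector_derivative_at_right_iff:
  "(f has_vector_derivative d) (at_right u) \<longleftrightarrow>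
     ((\<lambda>v. (f v - f u) /\<^sub>R (v - u)) \<longlongrightarrow> d) (at_right u)"
proof -
  have "((\<lambda>v. (1 / norm (v - u)) *\<^sub>R (f v - (f u + (v - u) *\<^sub>R d))) \<longlongrightarrow> 0) (at_right u) \<longleftrightarrow>
        ((\<lambda>v. (f v - f u) /\<^sub>R (v - u) - d) \<longlongrightarrow> 0) (at_right u)"
  proof (rule filterlim_cong[OF refl refl])
    show "\<forall>\<^sub>F v in at_right u. (1 / norm (v - u)) *\<^sub>R (f v - (f u + (v - u) *\<^sub>R d)) =
            (f v - f u) /\<^sub>R (v - u) - d"
      by (rule eventually_mono[OF eventually_at_right_less])
        (simp add: scaleR_diff_right scaleR_add_right divide_inverse)
  qed
  then show ?thesis
    unfolding has_vector_derivative_def has_derivative_within LIM_zero_iff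
    by (simp add: bounded_linear_scaleR_left)
qed

text \<open>The library's \<open>differentiable_bound_general\<close> asks for two-sided derivatives, which are not
  available below.\<close>

lemma right_derivative_bound:
  fixes F :: "real \<Rightarrow> 'b::real_normed_vector" and \<Phi> :: "real \<Rightarrow> real"
  assumes "a \<le> b" and F: "continuous_on {a..b} F" and \<Phi>: "continuous_on {a..b} \<Phi>"
    and F': "\<And>u. a \<le> u \<Longrightarrow> u < b \<Longrightarrow> (F has_vector_derivative F' u) (at_right u)"
    and \<Phi>': "\<And>u. a \<le> u \<Longrightarrow> u < b \<Longrightarrow> (\<Phi> has_vector_derivative \<Phi>' u) (at_right u)"
    and le: "\<And>u. a \<le> u \<Longrightarrow> u < b \<Longrightarrow> norm (F' u) \<le> \<Phi>' u"
  shows "norm (F b - F a) \<le> \<Phi> b - \<Phi> a"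
proof -
  \<comment> \<open>The slack \<open>\<epsilon>\<close> makes the comparison of derivatives strict,
    and the difference quotients inherit a strict inequality just to the right of
    \<open>u\<close>.\<close>
  have *: "norm (F b - F a) - (\<Phi> b - \<Phi> a) \<le> \<epsilon> * (b - a)" if "\<epsilon> > 0" for \<epsilon>
  proof -
    define H where "H u = norm (F u - F a) - (\<Phi> u - \<Phi> a) - \<epsilon> * (u - a)" for u
    have H: "continuous_on {a..b} H"
      unfolding H_def by (intro continuous_intros F \<Phi>)
    \<comment> \<open>\<open>Z\<close> need not be an interval. It is enough that its greatest point
      \<open>u\<close>, if below \<open>b\<close>, would be followed by points with
      \<open>H v \<le> H u \<le> 0\<close>.\<close>
    define Z where "Z = {u \<in> {a..b}. H u \<in> {..0}}"
    have "compact Z"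
      unfolding Z_def using continuous_closed_preimage[OF H closed_atLeastAtMost, of "{..0}"]
      by (auto simp: vimage_def Int_def compact_eq_bounded_closed intro: bounded_subset[of "{a..b}"])
    moreover have "a \<in> Z"
      using \<open>a \<le> b\<close> by (simp add: Z_def H_def)
    ultimately obtain u where u: "u \<in> Z" and max: "\<And>v. v \<in> Z \<Longrightarrow> v \<le> u"
      using compact_attains_sup[of Z] by blast
    have "u = b"
    proof (rule ccontr)
      assume "u \<noteq> b"
      then have ub: "a \<le> u" "u < b" using u by (auto simp: Z_def)
      have "((\<lambda>v. norm ((F v - F u) /\<^sub>R (v - u)) - (\<Phi> v - \<Phi> u) /\<^sub>R (v - u)) \<longlongrightarrow>
              norm (F' u) - \<Phi>' u) (at_right u)"
        using F'[OF ub] \<Phi>'[OF ub] unfolding has_vector_derivative_at_right_iff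
        by (intro tendsto_intros)
      moreover have "norm (F' u) - \<Phi>' u < \<epsilon>" using le[OF ub] that by simp
      ultimately have "\<forall>\<^sub>F v in at_right u.
          norm ((F v - F u) /\<^sub>R (v - u)) - (\<Phi> v - \<Phi> u) /\<^sub>R (v - u) < \<epsilon>"
        by (rule order_tendstoD(2))
      moreover have "\<forall>\<^sub>F v in at_right u. v < b" "\<forall>\<^sub>F v in at_right u. u < v"
        using ub by (auto intro: eventually_at_right_less order_tendstoD(2)[OF tendsto_ident_at])
      ultimately have "\<forall>\<^sub>F v in at_right u. u < v \<and> v \<in> Z"
      proof eventually_elim
        case (elim v)
        then have "norm (F v - F u) - (\<Phi> v - \<Phi> u) \<le> \<epsilon> * (v - u)"
          by (simp add: divide_simps flip: left_diff_distrib)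
        moreover have "norm (F v - F a) \<le> norm (F v - F u) + norm (F u - F a)"
          using norm_triangle_ineq[of "F v - F u" "F u - F a"] by simp
        ultimately have "H v \<le> H u"
          by (simp add: H_def algebra_simps)
        then show ?case using u ub elim by (simp add: Z_def)
      qed
      then obtain v where "u < v" "v \<in> Z"
        using eventually_happens trivial_limit_at_right_real by blast
      then show False using max[of v] by simp
    qed
    then show ?thesis using u by (simp add: Z_def H_def)
  qed
  show ?thesis
  proof (cases "a = b")
    case False
    then have "b - a > 0" using \<open>a \<le> b\<close> by simp
    have "norm (F b - F a) - (\<Phi> b - \<Phi> a) \<le> 0 + e" if "e > 0" for e
      using *[of "e / (b - a)"] \<open>b - a > 0\<close> that by simp
    then have "norm (F b - F a) - (\<Phi> b - \<Phi> a) \<le> 0"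
      by (rule field_le_epsilon)
    then show ?thesis by simp
  qed simp
qed

lemma integral_has_vector_derivative_at_right:
  fixes f :: "real \<Rightarrow> 'b::banach"
  assumes "continuous_on {a..b} f" "a \<le> u" "u < b"
  shows "((\<lambda>v. integral {a..v} f) has_vector_derivative f u) (at_right u)"
proof -
  have "((\<lambda>v. integral {a..v} f) has_vector_derivative f u) (at u within {u..b})"
    by (rule has_vector_derivative_within_subset[OF integral_has_vector_derivative])
      (use assms in auto)
  then show ?thesis using assms by (simp add: at_within_Icc_at_right)
qed

section \<open>Gronwall inequalities\<close>

text \<open>The majorant \<open>a + b * integral {s..r} z\<close>, damped by
  \<open>exp (- (b * (r - s)))\<close>, cannot increase: its derivative is
  \<open>b * (z r - majorant)\<close> times a positive factor. At \<open>r = s\<close> it equals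
  \<open>a\<close>.\<close>

lemma gronwall:
  fixes z :: "real \<Rightarrow> real"
  assumes "s \<le> t" and z: "continuous_on {s..t} z" and "b \<ge> 0"
    and le: "\<And>r. r \<in> {s..t} \<Longrightarrow> z r \<le> a + b * integral {s..r} z"
  shows "z t \<le> a * exp (b * (t - s))"
proof -
  define w where "w r = (a + b * integral {s..r} z) * exp (- (b * (r - s)))" for r
  have I: "((\<lambda>r. integral {s..r} z) has_real_derivative z r) (at r within {s..t})"
    if "r \<in> {s..t}" for r
    using integral_has_real_derivative[OF z that] .
  have "w t \<le> w s"
  proof (rule DERIV_nonpos_imp_decreasing_open[OF \<open>s \<le> t\<close>])
    fix r assume r: "s < r" "r < t"
    then have "(w has_real_derivative
        b * (z r - (a + b * integral {s..r} z)) * exp (- (b * (r - s)))) (at r)"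
      unfolding w_def
      using I[of r] at_within_Icc_at[of s r t]
      by (auto intro!: derivative_eq_intros simp: algebra_simps)
    moreover have "b * (z r - (a + b * integral {s..r} z)) * exp (- (b * (r - s))) \<le> 0"
      using le[of r] r \<open>b \<ge> 0\<close> by (intro mult_nonpos_nonneg mult_nonneg_nonpos) auto
    ultimately show "\<exists>y. (w has_real_derivative y) (at r) \<and> y \<le> 0" by blast
  next
    show "continuous_on {s..t} w"
      unfolding w_def
      by (intro continuous_intros indefinite_integral_continuous_1 integrable_continuous_real z)
  qed
  moreover have "x \<le> a * exp q" if "x * exp (- q) \<le> a" for x q
    using that by (simp add: exp_minus divide_simps)
  ultimately have "a + b * integral {s..t} z \<le> a * exp (b * (t - s))"
    by (simp add: w_def)
  then show ?thesis using le[of t] \<open>s \<le> t\<close> by auto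
qed

text \<open>The kernel splits as
  \<open>exp (\<alpha> * (r - s)) * exp (- \<alpha> * (u - s))\<close>, so weighting
  \<open>z\<close> by the second factor leaves the constant kernel \<open>b\<close>.\<close>

lemma gronwall_exp:
  fixes z :: "real \<Rightarrow> real"
  assumes "s \<le> t" and z: "continuous_on {s..t} z" and "b \<ge> 0"
    and le: "\<And>r. r \<in> {s..t} \<Longrightarrow>
      z r \<le> a * exp (\<alpha> * (r - s)) + integral {s..r} (\<lambda>u. b * exp (\<alpha> * (r - u)) * z u)"
  shows "z t \<le> a * exp ((\<alpha> + b) * (t - s))"
proof -
  define w where "w r = exp (- \<alpha> * (r - s)) * z r" for r
  have w_z: "z r = exp (\<alpha> * (r - s)) * w r" for r
    by (simp add: w_def exp_minus)
  have "w t \<le> a * exp (b * (t - s))"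
  proof (rule gronwall[OF \<open>s \<le> t\<close> _ \<open>b \<ge> 0\<close>])
    show "continuous_on {s..t} w" unfolding w_def by (intro continuous_intros z)
    fix r assume r: "r \<in> {s..t}"
    have eq: "b * exp (\<alpha> * (r - u)) * z u = (exp (\<alpha> * (r - s)) * b) * w u" for u
    proof -
      have *: "exp (\<alpha> * (r - u)) = exp (\<alpha> * (r - s)) * exp (- \<alpha> * (u - s))"
        unfolding exp_add[symmetric] by (simp add: algebra_simps)
      show ?thesis unfolding * w_def by (simp only: mult_ac)
    qed
    have I: "integral {s..r} (\<lambda>u. b * exp (\<alpha> * (r - u)) * z u) = exp (\<alpha> * (r - s)) * b * integral {s..r} w"
      unfolding eq by simp
    have "exp (\<alpha> * (r - s)) * w r \<le> exp (\<alpha> * (r - s)) * (a + b * integral {s..r} w)"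
      using le[OF r] unfolding I w_z[of r] by (simp add: distrib_left mult_ac)
    then show "w r \<le> a + b * integral {s..r} w" by simp
  qed
  then have "z t \<le> exp (\<alpha> * (t - s)) * (a * exp (b * (t - s)))"
    by (simp add: w_z)
  also have "\<dots> = a * exp ((\<alpha> + b) * (t - s))"
    by (simp add: distrib_right exp_add)
  finally show ?thesis .
qed

section \<open>Mild solutions and exponentially bounded semigroups\<close>

lemma mild_solutionD:
  assumes "mild_solution T B s y"
  shows "continuous_on {s..} y"
    and "s \<le> t \<Longrightarrow> y t = T (t - s) (y s) + integral {s..t} (\<lambda>u. T (t - u) (B u (y u)))"
  using assms[unfolded mild_solution_def, THEN conjunct1]
    assms[unfolded mild_solution_def, THEN conjunct2, THEN spec, THEN mp, of t] by this+

locale exp_bounded_semigroup =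
  fixes T :: "real \<Rightarrow> 'a::banach \<Rightarrow>\<^sub>L 'a" and K \<alpha> :: real
  assumes C0: "C0_semigroup T"
    and norm_T: "t \<ge> 0 \<Longrightarrow> norm (T t) \<le> K * exp (\<alpha> * t)"
begin

lemma T_0 [simp]: "blinfun_apply (T 0) x = x"
  and T_add: "0 \<le> s \<Longrightarrow> 0 \<le> t \<Longrightarrow> blinfun_apply (T (s + t)) x = T s (T t x)"
  and T_at_0: "((\<lambda>t. blinfun_apply (T t) x) \<longlongrightarrow> x) (at_right 0)"
  using C0 by (auto simp: C0_semigroup_def)

lemma T_diff: "0 \<le> s \<Longrightarrow> s \<le> t \<Longrightarrow> blinfun_apply (T t) x = T s (T (t - s) x)"
  using T_add[of s "t - s"] by simp

lemma K_nonneg: "K \<ge> 0"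
  using norm_ge_zero[of "T 0"] norm_T[of 0] by (simp del: norm_ge_zero)

lemma norm_T_apply: "t \<ge> 0 \<Longrightarrow> norm (T t x) \<le> K * exp (\<alpha> * t) * norm x"
  using norm_blinfun[of "T t" x] norm_T[of t] by (meson mult_right_mono norm_ge_zero order_trans)

text \<open>Passing to \<open>\<bar>\<alpha>\<bar>\<close> makes the exponential bound uniform on
  \<open>{0..r}\<close> for either sign of \<open>\<alpha>\<close>.\<close>

lemma norm_T_le:
  assumes "0 \<le> t" "t \<le> r"
  shows "norm (T t) \<le> K * exp (\<bar>\<alpha>\<bar> * r)"
proof -
  have "\<alpha> * t \<le> \<bar>\<alpha>\<bar> * r" using assms by (intro mult_mono) auto
  then show ?thesis using norm_T[of t] K_nonneg assms
    by (smt (verit) exp_le_cancel_iff mult_left_mono)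
qed

text \<open>Factoring out the operator at the smaller time reduces continuity at any time to
  continuity at \<open>0\<close>.\<close>

lemma dist_T_le:
  assumes "0 \<le> s" "0 \<le> t" "s \<le> r" "t \<le> r"
  shows "norm (T t x - T s x) \<le> K * exp (\<bar>\<alpha>\<bar> * r) * norm (T \<bar>t - s\<bar> x - x)"
proof -
  have *: "norm (T t x - T s x) \<le> K * exp (\<bar>\<alpha>\<bar> * r) * norm (T \<bar>t - s\<bar> x - x)"
    if "0 \<le> s" "s \<le> t" "s \<le> r" for s t
  proof -
    have "T t x - T s x = T s (T (t - s) x - x)"
      using T_diff[OF that(1,2)] by (simp add: blinfun.diff_right)
    also have "norm \<dots> \<le> norm (T s) * norm (T (t - s) x - x)" by (rule norm_blinfun)
    also have "\<dots> \<le> K * exp (\<bar>\<alpha>\<bar> * r) * norm (T (t - s) x - x)"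
      using norm_T_le[of s r] that by (intro mult_right_mono) auto
    finally show ?thesis using that by simp
  qed
  show ?thesis
    using *[of s t] *[of t s] assms
    by (cases "s \<le> t") (auto simp: norm_minus_commute abs_minus_commute)
qed

text \<open>Joint continuity in time and vector: local boundedness of \<open>T\<close> controls the
  change from \<open>x\<close> to \<open>g w\<close>, and \<open>dist_T_le\<close> the change of
  time.\<close>

lemma tendsto_T:
  assumes f: "(f \<longlongrightarrow> s) \<F>" and "s \<ge> 0" and pos: "\<forall>\<^sub>F w in \<F>. f w \<ge> 0" and g: "(g \<longlongrightarrow> x) \<F>"
  shows "((\<lambda>w. T (f w) (g w)) \<longlongrightarrow> T s x) \<F>"
proof -
  \<comment> \<open>\<open>c\<close> bounds \<open>norm (T r)\<close> for
    \<open>0 \<le> r \<le> s + 1\<close>; the margin \<open>1\<close> lets \<open>f w\<close> exceed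
    \<open>s\<close>.\<close>
  define c where "c = K * exp (\<bar>\<alpha>\<bar> * (s + 1))"
  \<comment> \<open>\<open>f w - s\<close> may have either sign or vanish; the absolute value turns
    the right limit at \<open>0\<close> into a two-sided one.\<close>
  have T0: "((\<lambda>t. T \<bar>t\<bar> x) \<longlongrightarrow> x) (at 0)"
  proof -
    have "((\<lambda>t. T \<bar>t\<bar> x) \<longlongrightarrow> x) (at_right 0)"
      by (rule tendsto_cong[THEN iffD1, OF _ T_at_0])
        (use eventually_at_right_less[of "0::real"] in eventually_elim, simp)
    moreover have "filterlim uminus (at_right (0::real)) (at_left 0)"
      using at_left_minus[of "0::real"] by (simp add: filterlim_def filtermap_filtermap)
    from filterlim_compose[OF T_at_0 this] have "((\<lambda>t. T \<bar>t\<bar> x) \<longlongrightarrow> x) (at_left 0)"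
      by (rule tendsto_cong[THEN iffD1, rotated])
        (auto simp: eventually_at_filter)
    ultimately show ?thesis by (simp add: filterlim_split_at)
  qed
  have "isCont (\<lambda>t. T \<bar>t\<bar> x) 0"
    using T0 by (simp add: isCont_def)
  moreover have "((\<lambda>w. f w - s) \<longlongrightarrow> 0) \<F>" using f by (simp add: LIM_zero)
  ultimately have "((\<lambda>w. T \<bar>f w - s\<bar> x) \<longlongrightarrow> x) \<F>"
    using isCont_tendsto_compose[of 0 "\<lambda>t. T \<bar>t\<bar> x"] by simp
  then have "((\<lambda>w. c * norm (g w - x) + c * norm (T \<bar>f w - s\<bar> x - x)) \<longlongrightarrow>
               c * norm (x - x) + c * norm (x - x)) \<F>"
    by (intro tendsto_intros g)
  then have lim: "((\<lambda>w. c * norm (g w - x) + c * norm (T \<bar>f w - s\<bar> x - x)) \<longlongrightarrow> 0) \<F>" by simp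
  have "\<forall>\<^sub>F w in \<F>. f w < s + 1" using f by (rule order_tendstoD) simp
  with pos have "\<forall>\<^sub>F w in \<F>. norm (T (f w) (g w) - T s x) \<le>
      c * norm (g w - x) + c * norm (T \<bar>f w - s\<bar> x - x)"
  proof eventually_elim
    case (elim w)
    have "norm (T (f w) (g w - x)) \<le> norm (T (f w)) * norm (g w - x)" by (rule norm_blinfun)
    also have "\<dots> \<le> c * norm (g w - x)"
      unfolding c_def using elim by (intro mult_right_mono norm_T_le) auto
    finally have 1: "norm (T (f w) (g w - x)) \<le> c * norm (g w - x)" .
    have 2: "norm (T (f w) x - T s x) \<le> c * norm (T \<bar>f w - s\<bar> x - x)"
      unfolding c_def using elim \<open>s \<ge> 0\<close> by (intro dist_T_le) auto
    have "T (f w) (g w) - T s x = T (f w) (g w - x) + (T (f w) x - T s x)"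
      by (simp add: blinfun.diff_right)
    also have "norm \<dots> \<le> norm (T (f w) (g w - x)) + norm (T (f w) x - T s x)"
      by (rule norm_triangle_ineq)
    finally show ?case using 1 2 by linarith
  qed
  from Lim_null_comparison[OF this lim] show ?thesis by (simp add: LIM_zero_iff)
qed

lemma continuous_on_T:
  assumes "continuous_on X f" "continuous_on X g" "\<And>w. w \<in> X \<Longrightarrow> f w \<ge> 0"
  shows "continuous_on X (\<lambda>w. T (f w) (g w))"
  using assms unfolding continuous_on_def
  by (auto intro!: tendsto_T simp: eventually_at_filter)

section \<open>Right derivatives involving the semigroup and its generator\<close>

text \<open>The integrand itself depends on \<open>v\<close>. By joint continuity at
  \<open>(0, u)\<close> it is uniformly close to \<open>T 0 (f u) = f u\<close> once
  \<open>v\<close> is near \<open>u\<close>, and so is its average.\<close>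

lemma convolution_at_right:
  assumes f: "continuous_on {u..} f"
  shows "((\<lambda>v. integral {u..v} (\<lambda>w. T (v - w) (f w)) /\<^sub>R (v - u)) \<longlongrightarrow> f u) (at_right u)"
proof (rule tendstoI)
  fix e :: real assume "e > 0"
  have "continuous_on ({0..} \<times> {u..}) (\<lambda>p. T (fst p) (f (snd p)))"
    by (intro continuous_on_T continuous_on_compose2[OF f] continuous_intros) auto
  then obtain d where "d > 0" and d: "\<And>p. p \<in> {0..} \<times> {u..} \<Longrightarrow> dist p (0, u) < d \<Longrightarrow>
      dist (T (fst p) (f (snd p))) (T 0 (f u)) < e / 2"
    unfolding continuous_on_iff using \<open>e > 0\<close>
    by (elim ballE[of _ _ "(0,u)"] allE[of _ "e / 2"]) auto
  have "\<forall>\<^sub>F v in at_right u. v < u + d"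
    by (rule order_tendstoD[OF tendsto_ident_at]) (use \<open>d > 0\<close> in simp)
  with eventually_at_right_less[of u]
  show "\<forall>\<^sub>F v in at_right u.
      dist (integral {u..v} (\<lambda>w. T (v - w) (f w)) /\<^sub>R (v - u)) (f u) < e"
  proof eventually_elim
    case (elim v)
    have cont: "continuous_on {u..v} (\<lambda>w. T (v - w) (f w))"
      by (intro continuous_on_T continuous_on_subset[OF f] continuous_intros) auto
    then have int: "(\<lambda>w. T (v - w) (f w)) integrable_on {u..v}"
      by (rule integrable_continuous_real)
    have "norm (T (v - w) (f w) - f u) \<le> e / 2" if "w \<in> {u..v}" for w
    proof -
      \<comment> \<open>The offsets \<open>v - w\<close> and \<open>w - u\<close> add up to
        \<open>v - u\<close>, so one radius \<open>d\<close> serves all \<open>w\<close>.\<close>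
      have "dist (v - w, w) (0, u) \<le> (v - w) + (w - u)"
        using that sqrt_sum_squares_le_sum[of "v - w" "w - u"] by (simp add: dist_Pair_Pair dist_real_def)
      then show ?thesis using d[of "(v - w, w)"] that elim by (simp add: dist_norm)
    qed
    then have "norm (integral {u..v} (\<lambda>w. T (v - w) (f w) - f u)) \<le> e / 2 * (v - u)"
      using elim cont by (intro integral_bound) (auto intro!: continuous_intros)
    also have "integral {u..v} (\<lambda>w. T (v - w) (f w) - f u) =
        integral {u..v} (\<lambda>w. T (v - w) (f w)) - (v - u) *\<^sub>R f u"
      using int elim by (subst integral_diff) auto
    also have "\<dots> = (v - u) *\<^sub>R (integral {u..v} (\<lambda>w. T (v - w) (f w)) /\<^sub>R (v - u) - f u)"
      using elim by (simp add: scaleR_diff_right)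
    finally have "norm (integral {u..v} (\<lambda>w. T (v - w) (f w)) /\<^sub>R (v - u) - f u) \<le> e / 2"
      using elim by (simp add: mult.commute)
    then show ?case using \<open>e > 0\<close> by (simp add: dist_norm)
  qed
qed

text \<open>Shifting the variable gives
  \<open>T \<tau> (?I r) = ?I (\<tau> + r) - ?I \<tau>\<close>, so the quotient defining
  \<open>A (?I r)\<close> is the difference of the quotients of \<open>?I\<close> at
  \<open>r\<close> and at \<open>0\<close>. Since \<open>x\<close> is arbitrary, this can be applied
  to values of a mild solution outside \<open>D\<close>.\<close>

lemma generator_integral:
  assumes gen: "infinitesimal_generator T D A" and "r \<ge> 0"
  shows "integral {0..r} (\<lambda>\<sigma>. T \<sigma> x) \<in> D" (is "?I r \<in> D")
    and "A (integral {0..r} (\<lambda>\<sigma>. T \<sigma> x)) = T r x - x"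
proof -
  have cont: "continuous_on {a..} (\<lambda>\<sigma>. T \<sigma> x)" if "a \<ge> 0" for a
    using that by (intro continuous_on_T continuous_intros) auto
  have deriv: "(?I has_vector_derivative T v x) (at_right v)" if "v \<ge> 0" for v
    using that by (intro integral_has_vector_derivative_at_right[of 0 "v + 1"]
        continuous_on_subset[OF cont[of 0]]) auto
  have "((\<lambda>\<tau>. (?I (\<tau> + r) - ?I r) /\<^sub>R \<tau> - ?I \<tau> /\<^sub>R \<tau>) \<longlongrightarrow> T r x - x) (at_right 0)"
    using deriv[OF \<open>r \<ge> 0\<close>] deriv[of 0]
    unfolding has_vector_derivative_at_right_iff filterlim_at_right_to_0[of _ _ r]
    by (intro tendsto_diff) auto
  moreover have "\<forall>\<^sub>F \<tau> in at_right 0. (?I (\<tau> + r) - ?I r) /\<^sub>R \<tau> - ?I \<tau> /\<^sub>R \<tau> =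
      (T \<tau> (?I r) - ?I r) /\<^sub>R \<tau>"
    using eventually_at_right_less[of "0::real"]
  proof eventually_elim
    case (elim \<tau>)
    have int: "(\<lambda>\<sigma>. T \<sigma> x) integrable_on {a..b}" if "a \<ge> 0" for a b
      using that by (intro integrable_continuous_real continuous_on_subset[OF cont[of 0]]) auto
    have "T \<tau> (?I r) = integral {0..r} (\<lambda>\<sigma>. T \<tau> (T \<sigma> x))"
      by (rule integral_blinfun_apply[symmetric]) (rule int, simp)
    also have "\<dots> = integral {0..r} (\<lambda>\<sigma>. T (\<sigma> + \<tau>) x)"
      using elim by (intro integral_cong) (simp add: add.commute flip: T_add)
    also have "\<dots> = integral {\<tau>..r + \<tau>} (\<lambda>\<sigma>. T \<sigma> x)"
      using integral_shift_real_ivl[where a = \<tau> and c = \<tau> and b = "r + \<tau>" and f = "\<lambda>\<sigma>. T \<sigma> x"] by simp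
    also have "\<dots> = ?I (\<tau> + r) - ?I \<tau>"
      using Henstock_Kurzweil_Integration.integral_combine[where a = 0 and c = \<tau> and b = "r + \<tau>" and f = "\<lambda>\<sigma>. T \<sigma> x"] elim \<open>r \<ge> 0\<close> int[of 0 "r + \<tau>"]
      by (simp add: algebra_simps)
    finally show ?case by (simp add: scaleR_diff_right)
  qed
  ultimately have lim: "((\<lambda>\<tau>. (T \<tau> (?I r) - ?I r) /\<^sub>R \<tau>) \<longlongrightarrow> T r x - x) (at_right 0)"
    by (rule Lim_transform_eventually)
  show "?I r \<in> D"
    using gen lim unfolding infinitesimal_generator_def by blast
  then have "((\<lambda>\<tau>. (T \<tau> (?I r) - ?I r) /\<^sub>R \<tau>) \<longlongrightarrow> A (?I r)) (at_right 0)"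
    using gen unfolding infinitesimal_generator_def by blast
  then show "A (?I r) = T r x - x"
    using lim by (intro tendsto_unique) auto
qed

text \<open>Only the right derivative exists in general, since \<open>A (C v (y v))\<close> need not be continuous in
  \<open>v\<close>. The vector \<open>y v\<close> need not lie in \<open>D\<close>; the extension \<open>E\<close> enters through
  \<open>C u (T r x - x) = E (integral {0..r} (\<lambda>\<sigma>. T \<sigma> x))\<close>.\<close>

lemma T_conj_has_right_derivative:
  fixes C :: "real \<Rightarrow> 'a \<Rightarrow>\<^sub>L 'a"
  assumes gen: "infinitesimal_generator T D A"
    and "u < t"
    and C': "(C has_vector_derivative C') (at_right u)"
    and range: "range (C u) \<subseteq> D"
    and E: "bounded_extension D (\<lambda>x. C u (A x)) E"
    and y: "continuous_on {u..} y" and f: "continuous_on {u..} f"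
    and voc: "\<And>v. v \<ge> u \<Longrightarrow> y v = T (v - u) (y u) + integral {u..v} (\<lambda>w. T (v - w) (f w))"
  shows "((\<lambda>v. T (t - v) (C v (y v))) has_vector_derivative
           T (t - u) (C' (y u) + C u (f u) + E (y u) - A (C u (y u)))) (at_right u)"
proof -
  define c where "c = C u (y u)"
  define J where "J v = integral {u..v} (\<lambda>w. T (v - w) (f w))" for v
  define I where "I r = integral {0..r} (\<lambda>\<sigma>. T \<sigma> (y u))" for r
  define Q where "Q v = ((C v - C u) /\<^sub>R (v - u)) (y v) + C u (J v /\<^sub>R (v - u))
      + E (I (v - u) /\<^sub>R (v - u)) - (T (v - u) c - c) /\<^sub>R (v - u)" for v
  have shift: "(g \<longlongrightarrow> l) (at_right u) \<longleftrightarrow> ((\<lambda>\<tau>. g (\<tau> + u)) \<longlongrightarrow> l) (at_right 0)"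
    for g :: "real \<Rightarrow> 'a" and l
    by (rule filterlim_at_right_to_0)
  have "continuous_on {u..t} y" using y by (rule continuous_on_subset) auto
  then have "(y \<longlongrightarrow> y u) (at_right u)"
    using \<open>u < t\<close> by (rule continuous_on_Icc_at_rightD)
  moreover have "((\<lambda>v. (C v - C u) /\<^sub>R (v - u)) \<longlongrightarrow> C') (at_right u)"
    using C' by (simp add: has_vector_derivative_at_right_iff)
  ultimately have 1: "((\<lambda>v. ((C v - C u) /\<^sub>R (v - u)) (y v)) \<longlongrightarrow> C' (y u)) (at_right u)"
    by (intro tendsto_intros)
  have 2: "((\<lambda>v. C u (J v /\<^sub>R (v - u))) \<longlongrightarrow> C u (f u)) (at_right u)"
    unfolding J_def by (intro tendsto_intros convolution_at_right f)
  have "(I has_vector_derivative T 0 (y u)) (at_right 0)"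
    unfolding I_def
    by (intro integral_has_vector_derivative_at_right[of 0 1] continuous_on_T continuous_intros) auto
  then have "((\<lambda>r. I r /\<^sub>R r) \<longlongrightarrow> y u) (at_right 0)"
    by (simp add: has_vector_derivative_at_right_iff I_def)
  then have "((\<lambda>v. I (v - u) /\<^sub>R (v - u)) \<longlongrightarrow> y u) (at_right u)"
    by (simp add: shift)
  then have 3: "((\<lambda>v. E (I (v - u) /\<^sub>R (v - u))) \<longlongrightarrow> E (y u)) (at_right u)"
    by (intro tendsto_intros)
  have "c \<in> D" using range by (auto simp: c_def)
  then have "((\<lambda>r. (T r c - c) /\<^sub>R r) \<longlongrightarrow> A c) (at_right 0)"
    using gen by (auto simp: infinitesimal_generator_def)
  then have 4: "((\<lambda>v. (T (v - u) c - c) /\<^sub>R (v - u)) \<longlongrightarrow> A c) (at_right u)"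
    by (simp add: shift)
  have Q: "(Q \<longlongrightarrow> C' (y u) + C u (f u) + E (y u) - A c) (at_right u)"
    unfolding Q_def by (intro tendsto_intros 1 2 3 4)
  have vt: "\<forall>\<^sub>F v in at_right u. v < t"
    by (rule order_tendstoD[OF tendsto_ident_at \<open>u < t\<close>])
  \<comment> \<open>\<open>T (t - v)\<close> converges only strongly, so the limit is taken jointly
    in the time and the argument.\<close>
  then have "((\<lambda>v. T (t - v) (Q v)) \<longlongrightarrow> T (t - u) (C' (y u) + C u (f u) + E (y u) - A c)) (at_right u)"
    using \<open>u < t\<close> by (intro tendsto_T Q tendsto_intros) (auto elim!: eventually_mono)
  moreover have "\<forall>\<^sub>F v in at_right u. T (t - v) (Q v) =
      (T (t - v) (C v (y v)) - T (t - u) (C u (y u))) /\<^sub>R (v - u)"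
    using vt eventually_at_right_less[of u]
  proof eventually_elim
    case (elim v)
    have "E (I (v - u)) = C u (T (v - u) (y u) - y u)"
      using E generator_integral[OF gen, of "v - u" "y u"] elim
      by (auto simp: bounded_extension_def I_def)
    moreover have "y v = T (v - u) (y u) + J v"
      using voc[of v] elim by (simp add: J_def)
    \<comment> \<open>After inserting both facts, \<open>C u (y v)\<close> and \<open>c\<close> each
      occur with both signs and cancel.\<close>
    ultimately have "(v - u) *\<^sub>R Q v = C v (y v) - T (v - u) c"
      using elim by (simp add: Q_def c_def scaleR_add_right scaleR_diff_right blinfun.bilinear_simps)
    then have "Q v = (C v (y v) - T (v - u) c) /\<^sub>R (v - u)"
      using elim by (metis diff_gt_0_iff_gt divideR_right less_irrefl)
    then have "T (t - v) (Q v) = (T (t - v) (C v (y v)) - T (t - v) (T (v - u) c)) /\<^sub>R (v - u)"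
      by (simp add: blinfun.bilinear_simps)
    also have "T (t - v) (T (v - u) c) = T (t - u) c"
      using T_add[of "t - v" "v - u" c] elim by simp
    finally show ?case by (simp add: c_def)
  qed
  ultimately show ?thesis
    unfolding has_vector_derivative_at_right_iff c_def[symmetric]
    by (rule Lim_transform_eventually)
qed

section \<open>Growth of mild solutions over one interval\<close>

text \<open>The semigroup law carries \<open>T (t - r)\<close> under the integral. Restarting serves
  both the right derivative at an intermediate time and the later stepping by
  \<open>h\<close>.\<close>

lemma mild_solution_restart:
  assumes y: "mild_solution T B s y" and B: "continuous_on UNIV B" and "s \<le> r"
  shows "mild_solution T B r y"
proof -
  have cy: "continuous_on {s..} y"
    and voc: "\<And>t. t \<ge> s \<Longrightarrow> y t = T (t - s) (y s) + integral {s..t} (\<lambda>u. T (t - u) (B u (y u)))"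
    by (fact mild_solutionD[OF y])+
  have cf: "continuous_on {s..} (\<lambda>u. B u (y u))"
    by (intro continuous_intros cy continuous_on_subset[OF B]) auto
  have int: "(\<lambda>u. T (t - u) (B u (y u))) integrable_on {s..t}" for t
    by (intro integrable_continuous_real continuous_on_T continuous_intros continuous_on_subset[OF cf]) auto
  have "y t = T (t - r) (y r) + integral {r..t} (\<lambda>u. T (t - u) (B u (y u)))" if "t \<ge> r" for t
  proof -
    have "T (t - r) (integral {s..r} (\<lambda>u. T (r - u) (B u (y u)))) =
        integral {s..r} (\<lambda>u. T (t - r) (T (r - u) (B u (y u))))"
      by (intro integral_blinfun_apply[symmetric] int)
    also have "\<dots> = integral {s..r} (\<lambda>u. T (t - u) (B u (y u)))"
    proof (rule integral_cong)
      fix u assume "u \<in> {s..r}"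
      then show "T (t - r) (T (r - u) (B u (y u))) = T (t - u) (B u (y u))"
        using T_add[of "t - r" "r - u" "B u (y u)"] \<open>t \<ge> r\<close> by simp
    qed
    finally have 1: "T (t - r) (y r) = T (t - s) (y s) + integral {s..r} (\<lambda>u. T (t - u) (B u (y u)))"
      using T_add[of "t - r" "r - s" "y s"] \<open>t \<ge> r\<close> \<open>s \<le> r\<close>
      by (subst voc[OF \<open>s \<le> r\<close>]) (simp add: blinfun.add_right)
    have 2: "integral {s..r} (\<lambda>u. T (t - u) (B u (y u))) + integral {r..t} (\<lambda>u. T (t - u) (B u (y u)))
        = integral {s..t} (\<lambda>u. T (t - u) (B u (y u)))"
      using \<open>s \<le> r\<close> \<open>t \<ge> r\<close> by (intro Henstock_Kurzweil_Integration.integral_combine int)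
    have 3: "y t = T (t - s) (y s) + integral {s..t} (\<lambda>u. T (t - u) (B u (y u)))"
      using \<open>s \<le> r\<close> \<open>t \<ge> r\<close> by (intro voc) simp
    show ?thesis unfolding 1 3 add.assoc 2 ..
  qed
  moreover have "continuous_on {r..} y"
    using cy by (rule continuous_on_subset) (use \<open>s \<le> r\<close> in auto)
  ultimately show ?thesis unfolding mild_solution_def by (intro conjI allI impI)
qed

text \<open>\<open>C u\<close> stands for \<open>C t u\<close> with \<open>t\<close> fixed, and
  \<open>m\<close> will be \<open>M * \<delta>\<close>. The constant \<open>3\<close> counts the
  terms with \<open>C u o\<^sub>L B u\<close>, with the extension of \<open>C u A\<close>, and with
  \<open>A C u\<close>; \<open>1 + \<delta>\<close> comes from
  \<open>y s - C s (y s)\<close>.\<close>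

lemma mild_solution_norm_le:
  fixes C :: "real \<Rightarrow> 'a \<Rightarrow>\<^sub>L 'a"
  assumes gen: "infinitesimal_generator T D A"
    and y: "mild_solution T B s y" and B: "continuous_on UNIV B"
    and "s \<le> t"
    and C: "\<And>u. u \<in> {s..t} \<Longrightarrow> C u = - integral {u..t} B"
    and "norm (C s) \<le> \<delta>"
    and CB: "\<And>u. u \<in> {s..t} \<Longrightarrow> norm (C u o\<^sub>L B u) \<le> m"
    and CA: "\<And>u. u \<in> {s..t} \<Longrightarrow> \<exists>E. bounded_extension D (\<lambda>x. C u (A x)) E \<and> norm E \<le> m"
    and AC: "\<And>u. u \<in> {s..t} \<Longrightarrow>
      range (C u) \<subseteq> D \<and> bounded_linear (\<lambda>x. A (C u x)) \<and> onorm (\<lambda>x. A (C u x)) \<le> m"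
  shows "norm (y t) \<le> (1 + \<delta>) * K * norm (y s) * exp (\<alpha> * (t - s)) +
           integral {s..t} (\<lambda>u. 3 * K * m * exp (\<alpha> * (t - u)) * norm (y u))"
proof -
  have cy: "continuous_on {s..} y"
    and voc: "\<And>t. t \<ge> s \<Longrightarrow> y t = T (t - s) (y s) + integral {s..t} (\<lambda>u. T (t - u) (B u (y u)))"
    by (fact mild_solutionD[OF y])+
  obtain E where E: "\<And>u. u \<in> {s..t} \<Longrightarrow> bounded_extension D (\<lambda>x. C u (A x)) (E u)"
    and norm_E: "\<And>u. u \<in> {s..t} \<Longrightarrow> norm (E u) \<le> m"
    using CA by metis
  \<comment> \<open>\<open>C\<close> is prescribed only on \<open>{s..t}\<close>. There
    \<open>C\<^sub>0\<close> agrees with it, and up to a constant it is an integral with variable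
    upper limit, to which the derivative rule applies.\<close>
  define C\<^sub>0 where "C\<^sub>0 u = integral {s..u} B - integral {s..t} B" for u
  have intB: "B integrable_on {a..b}" for a b
    by (intro integrable_continuous_real continuous_on_subset[OF B]) auto
  have C\<^sub>0: "C\<^sub>0 u = C u" if "u \<in> {s..t}" for u
    using Henstock_Kurzweil_Integration.integral_combine[where a = s and c = u and b = t and f = B] that C[OF that] intB by (simp add: C\<^sub>0_def algebra_simps)
  define P where "P v = integral {s..v} (\<lambda>w. T (t - w) (B w (y w)))" for v
  \<comment> \<open>Differentiating the first term yields \<open>T (t - u) (B u (y u))\<close>,
    which \<open>m\<close> does not control. Subtracting \<open>P\<close> cancels it, so
    \<open>m\<close> bounds every term left in \<open>F'\<close>.\<close>
  define F where "F v = T (t - v) (C\<^sub>0 v (y v)) - P v" for v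
  define F' where "F' u = T (t - u) (C u (B u (y u)) + E u (y u) - A (C u (y u)))" for u
  define \<phi> where "\<phi> u = 3 * K * m * exp (\<alpha> * (t - u)) * norm (y u)" for u
  have cf: "continuous_on {s..} (\<lambda>w. B w (y w))"
    by (intro continuous_intros cy continuous_on_subset[OF B]) auto
  have cTf: "continuous_on {s..t} (\<lambda>w. T (t - w) (B w (y w)))"
    by (intro continuous_on_T continuous_intros continuous_on_subset[OF cf]) auto
  have c\<phi>: "continuous_on {s..t} \<phi>"
    unfolding \<phi>_def by (intro continuous_intros continuous_on_subset[OF cy]) auto
  have "norm (F t - F s) \<le> integral {s..t} \<phi> - integral {s..s} \<phi>"
  proof (rule right_derivative_bound[OF \<open>s \<le> t\<close>])
    have "continuous_on {s..t} C\<^sub>0"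
      unfolding C\<^sub>0_def by (intro continuous_intros indefinite_integral_continuous_1 intB)
    then show "continuous_on {s..t} F"
      unfolding F_def P_def
      by (intro continuous_on_T continuous_intros continuous_on_subset[OF cy]
          indefinite_integral_continuous_1 integrable_continuous_real cTf) auto
    show "continuous_on {s..t} (\<lambda>v. integral {s..v} \<phi>)"
      by (intro indefinite_integral_continuous_1 integrable_continuous_real c\<phi>)
  next
    fix u assume u: "s \<le> u" "u < t"
    then have u': "u \<in> {s..t}" by simp
    have "mild_solution T B u y" by (rule mild_solution_restart[OF y B \<open>s \<le> u\<close>])
    then have voc_u: "\<And>v. v \<ge> u \<Longrightarrow>
        y v = T (v - u) (y u) + integral {u..v} (\<lambda>w. T (v - w) (B w (y w)))"
      by (rule mild_solutionD)
    have "(C\<^sub>0 has_vector_derivative B u - 0) (at_right u)"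
      unfolding C\<^sub>0_def using u
      by (intro has_vector_derivative_diff has_vector_derivative_const
          integral_has_vector_derivative_at_right[of s t] continuous_on_subset[OF B]) auto
    then have "((\<lambda>v. T (t - v) (C\<^sub>0 v (y v))) has_vector_derivative
        T (t - u) (B u (y u) + C\<^sub>0 u (B u (y u)) + E u (y u) - A (C\<^sub>0 u (y u)))) (at_right u)"
      using AC[OF u'] E[OF u'] u
      by (intro T_conj_has_right_derivative[OF gen _ _ _ _ _ _ voc_u] continuous_on_subset[OF cy]
          continuous_on_subset[OF cf]) (auto simp: C\<^sub>0)
    moreover have "(P has_vector_derivative T (t - u) (B u (y u))) (at_right u)"
      unfolding P_def by (rule integral_has_vector_derivative_at_right[OF cTf u])
    ultimately have "(F has_vector_derivative
        T (t - u) (B u (y u) + C\<^sub>0 u (B u (y u)) + E u (y u) - A (C\<^sub>0 u (y u)))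
          - T (t - u) (B u (y u))) (at_right u)"
      unfolding F_def by (rule has_vector_derivative_diff)
    then show "(F has_vector_derivative F' u) (at_right u)"
      by (simp add: F'_def C\<^sub>0[OF u'] blinfun.bilinear_simps algebra_simps)
    show "((\<lambda>v. integral {s..v} \<phi>) has_vector_derivative \<phi> u) (at_right u)"
      by (rule integral_has_vector_derivative_at_right[OF c\<phi> u])
    have "norm (C u (B u (y u))) \<le> m * norm (y u)"
      using norm_blinfun[of "C u o\<^sub>L B u" "y u"] CB[OF u']
      unfolding blinfun_apply_blinfun_compose
      by (meson mult_right_mono norm_ge_zero order_trans)
    moreover have "norm (E u (y u)) \<le> m * norm (y u)"
      using norm_blinfun[of "E u" "y u"] norm_E[OF u'] by (meson mult_right_mono norm_ge_zero order_trans)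
    moreover have "norm (A (C u (y u))) \<le> m * norm (y u)"
      using onorm[of "\<lambda>x. A (C u x)" "y u"] AC[OF u'] by (meson mult_right_mono norm_ge_zero order_trans)
    ultimately have "norm (C u (B u (y u)) + E u (y u) - A (C u (y u))) \<le> 3 * (m * norm (y u))"
      using norm_triangle_ineq4[of "C u (B u (y u)) + E u (y u)" "A (C u (y u))"]
        norm_triangle_ineq[of "C u (B u (y u))" "E u (y u)"] by linarith
    then have "norm (F' u) \<le> K * exp (\<alpha> * (t - u)) * (3 * (m * norm (y u)))"
      unfolding F'_def using u K_nonneg
      by (intro order_trans[OF norm_T_apply] mult_left_mono) auto
    then show "norm (F' u) \<le> \<phi> u" by (simp add: \<phi>_def mult_ac)
  qed
  \<comment> \<open>As \<open>C\<^sub>0 t = 0\<close> and \<open>P s = 0\<close>,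
    \<open>F t - F s\<close> equals \<open>- P t - T (t - s) (C s (y s))\<close>, and
    \<open>P t\<close> is the integral in the formula for \<open>y t\<close>.\<close>
  moreover have "y t = T (t - s) (y s - C s (y s)) - (F t - F s)"
    using voc[OF \<open>s \<le> t\<close>] \<open>s \<le> t\<close> C\<^sub>0[of s] by (simp add: F_def P_def C\<^sub>0_def[of t] blinfun.bilinear_simps)
  then have "norm (y t) \<le> norm (T (t - s) (y s - C s (y s))) + norm (F t - F s)"
    using norm_triangle_ineq4 by metis
  moreover have "norm (T (t - s) (y s - C s (y s))) \<le> K * exp (\<alpha> * (t - s)) * ((1 + \<delta>) * norm (y s))"
  proof -
    have "norm (C s (y s)) \<le> \<delta> * norm (y s)"
      using norm_blinfun[of "C s" "y s"] \<open>norm (C s) \<le> \<delta>\<close> by (meson mult_right_mono norm_ge_zero order_trans)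
    then have "norm (y s - C s (y s)) \<le> (1 + \<delta>) * norm (y s)"
      using norm_triangle_ineq4[of "y s" "C s (y s)"] by (simp add: algebra_simps)
    then show ?thesis
      using \<open>s \<le> t\<close> K_nonneg by (intro order_trans[OF norm_T_apply] mult_left_mono) auto
  qed
  ultimately show ?thesis by (simp add: \<phi>_def[abs_def] mult_ac)
qed

end

section \<open>Iteration over long intervals and asymptotic stability\<close>

text \<open>The increment \<open>ln L / h\<close> makes a full step cost exactly
  \<open>exp (\<beta> * h)\<close>. Only the piece next to \<open>a\<close> keeps the factor
  \<open>L\<close>; there \<open>\<gamma> \<le> \<beta>\<close>, by \<open>L \<ge> 1\<close>,
  suffices.\<close>

lemma iterate_exp_bound:
  fixes y :: "real \<Rightarrow> real"
  assumes "h > 0" and "L \<ge> 1"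
    and nonneg: "\<And>t. y t \<ge> 0"
    and step: "\<And>s t. a \<le> s \<Longrightarrow> s \<le> t \<Longrightarrow> t - s \<le> h \<Longrightarrow> y t \<le> L * exp (\<gamma> * (t - s)) * y s"
    and "a \<le> t"
  shows "y t \<le> L * exp ((\<gamma> + ln L / h) * (t - a)) * y a"
proof -
  define \<beta> where "\<beta> = \<gamma> + ln L / h"
  have "ln L / h \<ge> 0" using assms by simp
  then have "\<gamma> \<le> \<beta>" by (simp add: \<beta>_def)
  have exp_h: "L * exp (\<gamma> * h) = exp (\<beta> * h)"
    using assms by (simp add: \<beta>_def exp_add distrib_right)
  \<comment> \<open>Counting with \<open>Suc n\<close> makes \<open>n = 0\<close> a single interval
    of length at most \<open>h\<close>, to which \<open>step\<close> applies directly.\<close>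
  have "y t \<le> L * exp (\<beta> * (t - a)) * y a" if "a \<le> t" "t - a \<le> real (Suc n) * h" for n t
    using that
  proof (induction n arbitrary: t)
    case 0
    then have "y t \<le> L * exp (\<gamma> * (t - a)) * y a" by (intro step) auto
    also have "\<dots> \<le> L * exp (\<beta> * (t - a)) * y a"
      using 0 \<open>\<gamma> \<le> \<beta>\<close> \<open>L \<ge> 1\<close> nonneg by (intro mult_right_mono mult_left_mono) (auto intro: mult_right_mono)
    finally show ?case .
  next
    case (Suc n)
    show ?case
    proof (cases "t - a \<le> real (Suc n) * h")
      case True
      then show ?thesis using Suc by simp
    next
      case False
      have "h \<le> real (Suc n) * h" using \<open>h > 0\<close> by (simp add: algebra_simps)
      then have ah: "a \<le> t - h" using False by linarith
      have "y t \<le> exp (\<beta> * h) * y (t - h)"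
        using step[of "t - h" t] ah \<open>h > 0\<close> exp_h by simp
      also have "\<dots> \<le> exp (\<beta> * h) * (L * exp (\<beta> * (t - h - a)) * y a)"
        using Suc.prems ah by (intro mult_left_mono Suc.IH) (auto simp: algebra_simps)
      also have "\<dots> = L * (exp (\<beta> * h) * exp (\<beta> * (t - h - a))) * y a"
        by (simp only: mult_ac)
      also have "exp (\<beta> * h) * exp (\<beta> * (t - h - a)) = exp (\<beta> * (t - a))"
        unfolding exp_add[symmetric] by (simp add: algebra_simps)
      finally show ?thesis .
    qed
  qed
  moreover obtain n where "(t - a) / h \<le> real n" using real_arch_simple by blast
  then have "t - a \<le> real (Suc n) * h" using \<open>h > 0\<close> by (simp add: field_simps)
  ultimately show ?thesis using \<open>a \<le> t\<close> by (simp add: \<beta>_def)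
qed

text \<open>For \<open>t \<ge> s\<close> the exponential is at most \<open>1\<close>, so
  \<open>\<eta> = \<epsilon> / c\<close> gives stability; its decay gives attraction.\<close>

lemma asymptotically_stableI:
  assumes "\<beta> < 0" and "c > 0"
    and le: "\<And>s t y. mild_solution T B s y \<Longrightarrow> s \<le> t \<Longrightarrow> norm (y t) \<le> c * exp (\<beta> * (t - s)) * norm (y s)"
  shows "asymptotically_stable T B"
  unfolding asymptotically_stable_def
proof (intro conjI allI impI)
  fix s \<epsilon> :: real assume "\<epsilon> > 0"
  have "norm (y t) < \<epsilon>" if y: "mild_solution T B s y" "norm (y s) < \<epsilon> / c" and "s \<le> t" for y t
  proof -
    have "exp (\<beta> * (t - s)) \<le> 1"
      using \<open>\<beta> < 0\<close> \<open>s \<le> t\<close> by (simp add: mult_nonpos_nonneg)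
    then have "norm (y t) \<le> c * 1 * norm (y s)"
      using \<open>c > 0\<close> by (intro order_trans[OF le[OF y(1) \<open>s \<le> t\<close>]] mult_right_mono mult_left_mono) auto
    then show ?thesis using y(2) \<open>c > 0\<close> by (simp add: field_simps)
  qed
  then show "\<exists>\<eta>>0. \<forall>y. mild_solution T B s y \<and> norm (y s) < \<eta> \<longrightarrow> (\<forall>t\<ge>s. norm (y t) < \<epsilon>)"
    using \<open>\<epsilon> > 0\<close> \<open>c > 0\<close> by (intro exI[of _ "\<epsilon> / c"]) auto
next
  fix s y assume y: "mild_solution T B s y"
  have "filterlim (\<lambda>t. - s + t) at_top at_top"
    by (rule filterlim_tendsto_add_at_top[OF tendsto_const filterlim_ident])
  then have "filterlim (\<lambda>t. \<beta> * (- s + t)) at_bot at_top"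
    by (rule filterlim_tendsto_neg_mult_at_bot[OF tendsto_const \<open>\<beta> < 0\<close>])
  then have "filterlim (\<lambda>t. \<beta> * (t - s)) at_bot at_top" by simp
  then have "((\<lambda>t. exp (\<beta> * (t - s))) \<longlongrightarrow> 0) at_top"
    by (rule filterlim_compose[OF exp_at_bot])
  then have "((\<lambda>t. c * exp (\<beta> * (t - s)) * norm (y s)) \<longlongrightarrow> c * 0 * norm (y s)) at_top"
    by (intro tendsto_intros)
  then have lim: "((\<lambda>t. c * exp (\<beta> * (t - s)) * norm (y s)) \<longlongrightarrow> 0) at_top" by simp
  show "(y \<longlongrightarrow> 0) at_top"
    by (rule Lim_null_comparison[OF eventually_at_top_linorderI[OF le[OF y]] lim])
qed

section \<open>Orbits of the evolution operator and the final estimates\<close>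

lemma evolution_operatorD:
  assumes "evolution_operator T B S"
  shows "continuous_on {s..} (\<lambda>t. S t s x)"
    and "s \<le> t \<Longrightarrow> S t s x = T (t - s) x + integral {s..t} (\<lambda>u. T (t - u) (B u (S u s x)))"
  using assms[unfolded evolution_operator_def, THEN conjunct1, THEN spec, THEN spec, of s x]
    assms[unfolded evolution_operator_def, THEN conjunct2, THEN spec, THEN spec, THEN spec,
      THEN mp, of s t x]
  by this+

lemma evolution_operator_refl:
  assumes "evolution_operator T B S" "C0_semigroup T"
  shows "S s s x = x"
  by (subst evolution_operatorD(2)[OF assms(1) order_refl])
    (use assms(2) in \<open>simp add: C0_semigroup_def\<close>)

lemma mild_solution_evolution_operator:
  assumes "evolution_operator T B S" "C0_semigroup T"
  shows "mild_solution T B s (\<lambda>t. S t s x)"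
  unfolding mild_solution_def evolution_operator_refl[OF assms]
  by (intro conjI allI impI evolution_operatorD[OF assms(1)])

theorem theorem8:
  fixes T :: "real \<Rightarrow> 'a::banach \<Rightarrow>\<^sub>L 'a"
    and D :: "'a set" and A :: "'a \<Rightarrow> 'a"
    and B :: "real \<Rightarrow> 'a \<Rightarrow>\<^sub>L 'a"
    and C :: "real \<Rightarrow> real \<Rightarrow> 'a \<Rightarrow>\<^sub>L 'a"
    and S :: "real \<Rightarrow> real \<Rightarrow> 'a \<Rightarrow>\<^sub>L 'a"
    and K \<alpha> \<beta> h M \<delta> :: real
  assumes "closure D = UNIV"
    and "C0_semigroup T"
    and "infinitesimal_generator T D A"
    and "K \<ge> 1"
    and "\<forall>t\<ge>0. norm (T t) \<le> K * exp (\<alpha> * t)"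
    and "continuous_on UNIV B"
    and "\<forall>t. range (B t) \<subseteq> D"
    and "\<forall>t. bounded_linear (\<lambda>x. A (B t x))"
    and "\<forall>t. \<exists>E. bounded_extension D (\<lambda>x. B t (A x)) E"
    and "h > 0" and "M > 0" and "\<delta> > 0"
    and "\<forall>t u. \<bar>t - u\<bar> \<le> h \<longrightarrow> C t u = oriented_integral B t u"
    and "\<forall>t. norm (B t) \<le> M"
    and "\<forall>t u. \<bar>u - t\<bar> \<le> h \<longrightarrow> norm (C t u) \<le> \<delta>"
    and "\<forall>t u. \<bar>u - t\<bar> \<le> h \<longrightarrow> norm (C t u o\<^sub>L B u) \<le> M * \<delta>"
    and "\<forall>t u. \<bar>u - t\<bar> \<le> h \<longrightarrow>
           (\<exists>E. bounded_extension D (\<lambda>x. C t u (A x)) E \<and> norm E \<le> M * \<delta>)"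
    and "\<forall>t u. \<bar>u - t\<bar> \<le> h \<longrightarrow>
           range (C t u) \<subseteq> D \<and> bounded_linear (\<lambda>x. A (C t u x)) \<and>
           onorm (\<lambda>x. A (C t u x)) \<le> M * \<delta>"
    and "evolution_operator T B S"
    and "\<beta> = \<alpha> + 3 * M * K * \<delta> + ln ((1 + \<delta>) * K) / h"
  shows "(\<forall>t s. s \<le> t \<longrightarrow> norm (S t s) \<le> (1 + \<delta>) * K * exp (\<beta> * (t - s))) \<and>
         (\<alpha> < 0 \<and> \<beta> < 0 \<longrightarrow> asymptotically_stable T B)"
proof -
  interpret exp_bounded_semigroup T K \<alpha>
    using assms(2,5) by unfold_locales auto
  \<comment> \<open>Length at most \<open>h\<close> keeps the whole interval where the bounds on
    \<open>C\<close> hold.\<close>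
  have short: "norm (y t) \<le> (1 + \<delta>) * K * exp ((\<alpha> + 3 * M * K * \<delta>) * (t - s)) * norm (y s)"
    if y: "mild_solution T B s y" and "s \<le> t" "t - s \<le> h" for y s t
  proof -
    have cy: "continuous_on {s..t} (\<lambda>r. norm (y r))"
      by (intro continuous_intros continuous_on_subset[OF mild_solutionD(1)[OF y]]) auto
    have "norm (y t) \<le> (1 + \<delta>) * K * norm (y s) * exp ((\<alpha> + 3 * K * (M * \<delta>)) * (t - s))"
    proof (rule gronwall_exp[OF \<open>s \<le> t\<close> cy])
      show "3 * K * (M * \<delta>) \<ge> 0" using assms(4,11,12) by simp
      fix r assume r: "r \<in> {s..t}"
      have near: "\<bar>u - r\<bar> \<le> h" if "u \<in> {s..r}" for u
        using r that \<open>t - s \<le> h\<close> by auto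
      show "norm (y r) \<le> (1 + \<delta>) * K * norm (y s) * exp (\<alpha> * (r - s)) +
          integral {s..r} (\<lambda>u. 3 * K * (M * \<delta>) * exp (\<alpha> * (r - u)) * norm (y u))"
      \<comment> \<open>The base point of \<open>C\<close> moves with the end point: every
        \<open>r\<close> uses its own \<open>C r\<close>, giving the inequality at all
        \<open>r\<close> as Gronwall requires.\<close>
      proof (rule mild_solution_norm_le[OF assms(3) y assms(6), of r "C r"])
        show "C r u = - integral {u..r} B" if "u \<in> {s..r}" for u
        proof -
          have "C r u = oriented_integral B r u"
            using assms(13) near[OF that] by (simp add: abs_minus_commute)
          \<comment> \<open>At \<open>u = r\<close> the other branch of
            \<open>oriented_integral\<close> applies; both integrals are then zero.\<close>
          then show ?thesis using that by (auto simp: oriented_integral_def)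
        qed
      qed (use r assms(15-18)[rule_format, OF near] in simp_all)
    qed
    then show ?thesis by (simp add: mult_ac)
  qed
  have "(1 + \<delta>) * K \<ge> 1 * 1" using assms(4,12) by (intro mult_mono) auto
  then have L: "(1 + \<delta>) * K \<ge> 1" by simp
  \<comment> \<open>One bound for all mild solutions serves both conclusions: orbits of
    \<open>S\<close> are mild solutions, and stability quantifies over mild solutions.\<close>
  have bound: "norm (y t) \<le> (1 + \<delta>) * K * exp (\<beta> * (t - s)) * norm (y s)"
    if y: "mild_solution T B s y" and "s \<le> t" for y s t
    unfolding assms(20)
    by (rule iterate_exp_bound[OF \<open>h > 0\<close> L norm_ge_zero _ \<open>s \<le> t\<close>])
      (intro short mild_solution_restart[OF y assms(6)])
  have "norm (S t s) \<le> (1 + \<delta>) * K * exp (\<beta> * (t - s))" if "s \<le> t" for s t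
  proof (rule norm_blinfun_bound)
    show "0 \<le> (1 + \<delta>) * K * exp (\<beta> * (t - s))" using L by simp
    show "norm (S t s x) \<le> (1 + \<delta>) * K * exp (\<beta> * (t - s)) * norm x" for x
      using bound[OF mild_solution_evolution_operator[OF assms(19,2)] that, of x]
      by (simp add: evolution_operator_refl[OF assms(19,2)])
  qed
  moreover have "asymptotically_stable T B" if "\<beta> < 0"
    using that L bound by (intro asymptotically_stableI[of \<beta> "(1 + \<delta>) * K"]) auto
  ultimately show ?thesis by blast
qed

end
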